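(* Let $X=[-1,1]\subset\mathbb{R}$ and $\mathcal{A}=\{\alpha_1,\ldots,\alpha_m\}\subset\mathbb{R}$ with $\alpha_1<\cdots<\alpha_m$, where $m\ge3$. The extremal rays of $C_X(\mathcal{A})$ are the following: (1) $\mathbb{R}_+\cdot\left(\exp(\alpha_2x)-\exp(\alpha_1-\alpha_2)\exp(\alpha_1x)\right)$, (2) $\mathbb{R}_+\cdot\left(\exp(\alpha_{m-1}x)-\exp(\alpha_{m-1}-\alpha_m)\exp(\alpha_mx)\right)$, (3) $\mathbb{R}_+\cdot\left(c_{i-1}\exp(\alpha_{i-1}x)+c_i\exp(\alpha_ix)+c_{i+1}\exp(\alpha_{i+1}x)\right)$ for $i\in\{2,\ldots,m-1\}$, with $$c_{i-1}>0,\quad c_{i+1}>0\quad\text{and}\quad c_i=-\left(\frac{c_{i-1}}{\lambda_{i-1}}\right)^{\lambda_{i-1}}\left(\frac{c_{i+1}}{\lambda_{i+1}}\right)^{\lambda_{i+1}},$$ where $$\lambda_{i-1}=\frac{\alpha_{i+1}-\alpha_i}{\alpha_{i+1}-\alpha_{i-1}},\quad \lambda_{i+1}=\frac{\alpha_i-\alpha_{i-1}}{\alpha_{i+1}-\alpha_{i-1}}\quad\text{and}\quad \alpha_{i-1}-\alpha_{i+1}\le\ln\frac{c_{i-1}\lambda_{i+1}}{c_{i+1}\lambda_{i-1}}\le\alpha_{i+1}-\alpha_{i-1}.$$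
   Context: For a non-empty convex set $X\subset\mathbb{R}^n$, a finite non-empty set $\mathcal{A}\subset\mathbb{R}^n$ and $\beta\in\mathcal{A}$, the $X$-AGE cone with respect to $\beta$ is $C_X(\mathcal{A},\beta)=\{f : f=\sum_{\alpha\in\mathcal{A}}c_\alpha\exp(\alpha^Tx)\text{ is non-negative on }X,\ c_\alpha\ge0\text{ for all }\alpha\in\mathcal{A}\setminus\{\beta\}\}$, where the $c_\alpha$ are real. The $X$-SAGE cone (conditional SAGE cone) supported on $\mathcal{A}$ is the Minkowski sum $C_X(\mathcal{A})=\sum_{\beta\in\mathcal{A}}C_X(\mathcal{A},\beta)$, a convex cone in the space of exponential sums $\sum_{\alpha\in\mathcal{A}}c_\alpha\exp(\alpha^Tx)$. *)

theory Defs
  imports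
    "HOL-Analysis.Analysis"
    "HOL-Library.Function_Algebras"
    "HOL-Library.Set_Algebras"
begin

text \<open>
  Together with the additive structure of Function\_Algebras, the pointwise scalar multiplication
  makes real vector space notions such as \<^const>\<open>face_of\<close> available for sets of functions.
\<close>

instantiation "fun" :: (type, real_vector) real_vector
begin

definition scaleR_fun :: "real \<Rightarrow> ('a \<Rightarrow> 'b) \<Rightarrow> 'a \<Rightarrow> 'b"
  where "scaleR_fun t f = (\<lambda>x. t *\<^sub>R f x)"

instance
  by standard (auto simp: scaleR_fun_def plus_fun_def scaleR_add_left scaleR_add_right)

end

definition exp_sum :: "'a::euclidean_space set \<Rightarrow> ('a \<Rightarrow> real) \<Rightarrow> 'a \<Rightarrow> real"
  where "exp_sum A c = (\<lambda>x. \<Sum>\<alpha>\<in>A. c \<alpha> * exp (\<alpha> \<bullet> x))"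

definition age_cone ::
    "'a::euclidean_space set \<Rightarrow> 'a set \<Rightarrow> 'a \<Rightarrow> ('a \<Rightarrow> real) set"
  where "age_cone X A \<beta> =
    {exp_sum A c | c. (\<forall>x\<in>X. 0 \<le> exp_sum A c x) \<and> (\<forall>\<alpha>\<in>A - {\<beta>}. 0 \<le> c \<alpha>)}"

text \<open>The sum is the Minkowski sum of sets of functions, from Set\_Algebras.\<close>

definition sage_cone ::
    "'a::euclidean_space set \<Rightarrow> 'a set \<Rightarrow> ('a \<Rightarrow> real) set"
  where "sage_cone X A = (\<Sum>\<beta>\<in>A. age_cone X A \<beta>)"

definition ray :: "'v::real_vector \<Rightarrow> 'v set"
  where "ray v = {t *\<^sub>R v | t. 0 \<le> t}"

definition extremal_ray :: "'v::real_vector set \<Rightarrow> 'v set \<Rightarrow> bool"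
  where "extremal_ray C R \<longleftrightarrow> (\<exists>v. v \<noteq> 0 \<and> R = ray v) \<and> R face_of C"

end

theory Submission
  imports Defs
begin

text \<open>
  Fix \<open>y \<in> [-1, 1]\<close> and write \<open>\<sigma>\<^sub>j\<close> for the difference quotient of \<open>a \<mapsto> exp (a (x - y))\<close> between
  \<open>\<alpha>\<^sub>j\<close> and \<open>\<alpha>\<^sub>j\<^sub>+\<^sub>1\<close>. The three-term functions of the theorem are positive multiples of
  \<open>\<sigma>\<^sub>j - \<sigma>\<^sub>j\<^sub>-\<^sub>1\<close>, and the two-term ones are multiples of \<open>\<sigma>\<^sub>1\<close> at \<open>y = -1\<close> and of \<open>-\<sigma>\<^sub>m\<^sub>-\<^sub>1\<close> at \<open>y = 1\<close>.

  They generate the cone: divide an AGE function with possibly negative coefficient at \<open>\<alpha>\<^sub>i\<close> by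
  \<open>exp (\<alpha>\<^sub>i x)\<close>, let \<open>y\<close> be a minimiser over \<open>[-1, 1]\<close> and split off the minimum. What remains vanishes at
  \<open>y\<close>, and a discrete Taylor formula writes it in terms of the \<open>\<sigma>\<^sub>j - \<sigma>\<^sub>j\<^sub>-\<^sub>1\<close>; the first-order
  conditions at \<open>y\<close> make the coefficients non-negative.

  Each of them is extremal: it vanishes on \<open>[-1, 1]\<close> only at \<open>y\<close>, so only generators with the same
  \<open>y\<close> occur in a decomposition, and these are linearly independent.
\<close>

section \<open>Linear independence and strict convexity of exponentials\<close>

text \<open>After division by the exponential with the largest exponent \<open>b\<close>, every
  other term tends to 0 at infinity, so \<open>c b\<close> vanishes; induction removes the exponents
  from the top.\<close>

lemma exp_sum_coeffs_zero:
  fixes A :: "real set"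
  assumes "finite A" and "\<And>x. (\<Sum>a\<in>A. c a * exp (a * x)) = 0"
  shows "\<forall>a\<in>A. c a = 0"
  using assms
proof (induction A rule: finite_linorder_max_induct)
  case empty
  then show ?case by simp
next
  case (insert b A)
  have nb: "b \<notin> A" using insert by auto
  have "((\<lambda>x. c b + (\<Sum>a\<in>A. c a * exp ((a - b) * x))) \<longlongrightarrow> c b + (\<Sum>a\<in>A. c a * 0)) at_top"
  proof (intro tendsto_intros)
    fix a assume "a \<in> A"
    then have "a - b < 0" using insert by auto
    then have "filterlim (\<lambda>x. (a - b) * x) at_bot at_top"
      by (simp add: filterlim_tendsto_neg_mult_at_bot[OF tendsto_const _ filterlim_ident])
    then show "((\<lambda>x. exp ((a - b) * x)) \<longlongrightarrow> 0) at_top"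
      by (rule filterlim_compose[OF exp_at_bot])
  qed
  moreover have "c b + (\<Sum>a\<in>A. c a * exp ((a - b) * x)) = 0" for x
  proof -
    have "c b + (\<Sum>a\<in>A. c a * exp ((a - b) * x))
        = exp (- b * x) * (\<Sum>a\<in>insert b A. c a * exp (a * x))"
      using insert(1) nb
      by (simp add: distrib_left sum_distrib_left mult.left_commute exp_minus
          flip: exp_add) (simp add: exp_diff exp_minus field_simps left_diff_distrib)
    then show ?thesis using insert.prems by simp
  qed
  ultimately have cb: "c b = 0" by (simp add: tendsto_const_iff)
  have "(\<Sum>a\<in>A. c a * exp (a * x)) = 0" for x
    using insert.prems[of x] insert(1) nb cb by simp
  then show ?case using insert.IH cb by simp
qed

text \<open>Squaring the weak inequality at \<open>y / 2\<close> gains the positive term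
  \<open>(y / 2)\<^sup>2\<close>.\<close>

lemma exp_gt_add_one: "1 + y < exp y" if "y \<noteq> 0" for y :: real
proof -
  have "1 + y / 2 \<le> exp (y / 2)" by (rule exp_ge_add_one_self)
  show ?thesis
  proof (cases "1 + y / 2 > 0")
    case True
    have "(1 + y / 2)\<^sup>2 = 1 + y + (y / 2)\<^sup>2" by (simp add: power2_eq_square field_simps)
    moreover have "0 < (y / 2)\<^sup>2" using that by simp
    ultimately have "1 + y < (1 + y / 2)\<^sup>2" by linarith
    also have "\<dots> \<le> (exp (y / 2))\<^sup>2" using True by (intro power_mono) auto
    also have "\<dots> = exp y" by (simp flip: exp_double)
    finally show ?thesis .
  next
    case False
    then show ?thesis using exp_gt_zero[of y] by linarith
  qed
qed

text \<open>Strict convexity of \<open>a \<mapsto> exp (a * s)\<close> in the exponent: a chord is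
  steeper than the tangent at its left end. The next lemma is the counterpart at the right
  end.\<close>

lemma exp_slope_gt:
  fixes p q s :: real
  assumes "p < q" "s \<noteq> 0"
  shows "s * exp (p * s) < (exp (q * s) - exp (p * s)) / (q - p)"
proof -
  have "exp (p * s) * (1 + (q - p) * s) < exp (p * s) * exp ((q - p) * s)"
    using exp_gt_add_one[of "(q - p) * s"] assms by simp
  also have "\<dots> = exp (q * s)" by (simp add: algebra_simps flip: exp_add)
  finally show ?thesis using assms by (simp add: field_simps)
qed

lemma exp_slope_less:
  fixes p q s :: real
  assumes "p < q" "s \<noteq> 0"
  shows "(exp (q * s) - exp (p * s)) / (q - p) < s * exp (q * s)"
proof -
  have "exp (q * s) * (1 - (q - p) * s) < exp (q * s) * exp (- ((q - p) * s))"
    using exp_gt_add_one[of "- ((q - p) * s)"] assms by simp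
  also have "\<dots> = exp (p * s)" by (simp add: algebra_simps flip: exp_add)
  finally show ?thesis using assms by (simp add: field_simps)
qed

section \<open>Rays, faces and conic closure of AGE cones\<close>

lemma ray_scaleR: "ray (t *\<^sub>R v) = ray v" if "0 < t"
proof -
  have "\<exists>r. s *\<^sub>R v = r *\<^sub>R t *\<^sub>R v \<and> 0 \<le> r" if "0 \<le> s" for s
    using that \<open>0 < t\<close> by (intro exI[of _ "s / t"]) simp
  then show ?thesis using that unfolding ray_def by (force intro: mult_nonneg_nonneg)
qed

lemma self_in_ray: "v \<in> ray v"
  unfolding ray_def by (auto intro: exI[of _ 1])

lemma ray_eqI:
  assumes "u \<in> ray v" "u \<noteq> 0"
  shows "ray u = ray v"
proof -
  obtain t where "u = t *\<^sub>R v" "0 \<le> t" using assms by (auto simp: ray_def)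
  then show ?thesis using assms ray_scaleR[of t v] by (cases "t = 0") auto
qed

lemma scaleR_in_ray: "t *\<^sub>R u \<in> ray v" if "u \<in> ray v" "0 \<le> t"
  using that by (auto simp: ray_def)

lemma convex_ray: "convex (ray v)"
  unfolding convex_def
proof (intro ballI allI impI)
  fix x y and u w :: real
  assume "x \<in> ray v" "y \<in> ray v" "0 \<le> u" "0 \<le> w"
  then obtain s t where "x = s *\<^sub>R v" "y = t *\<^sub>R v" "0 \<le> s" "0 \<le> t"
    by (auto simp: ray_def)
  then show "u *\<^sub>R x + w *\<^sub>R y \<in> ray v"
    using \<open>0 \<le> u\<close> \<open>0 \<le> w\<close> unfolding ray_def
    by (auto intro!: exI[of _ "u * s + w * t"] simp: scaleR_add_left)
qed

text \<open>Turns the segment condition for faces into an additive one: \<open>a + b\<close> is the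
  midpoint of \<open>2 *\<^sub>R a\<close> and \<open>2 *\<^sub>R b\<close>. For
  \<open>a = b\<close> that segment degenerates, but the sum is then \<open>2 *\<^sub>R a\<close>
  itself.\<close>

lemma ray_face_of_coneD:
  assumes "ray v face_of C" "a \<in> C" "b \<in> C" "a + b \<in> ray v"
    and cone: "\<And>f. f \<in> C \<Longrightarrow> 2 *\<^sub>R f \<in> C"
  shows "a \<in> ray v"
proof -
  have half: "(1 / 2) *\<^sub>R 2 *\<^sub>R a = a" by simp
  have "2 *\<^sub>R a \<in> ray v"
  proof (cases "a = b")
    case True
    then show ?thesis using assms(4) by (simp add: scaleR_2)
  next
    case False
    have "a + b \<in> open_segment (2 *\<^sub>R a) (2 *\<^sub>R b)"
      unfolding in_segment using False by (auto intro!: exI[of _ "1 / 2"])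
    from face_ofD[OF assms(1) this] show ?thesis using assms(2-4) cone by blast
  qed
  then show ?thesis using scaleR_in_ray[of "2 *\<^sub>R a" v "1 / 2"] half by simp
qed

lemma age_cone_convex_cone:
  assumes "f \<in> age_cone X A b" "g \<in> age_cone X A b" "0 \<le> t"
  shows "f + t *\<^sub>R g \<in> age_cone X A b"
proof -
  obtain c d where c: "f = exp_sum A c" "\<forall>x\<in>X. 0 \<le> exp_sum A c x" "\<forall>a\<in>A - {b}. 0 \<le> c a"
    and d: "g = exp_sum A d" "\<forall>x\<in>X. 0 \<le> exp_sum A d x" "\<forall>a\<in>A - {b}. 0 \<le> d a"
    using assms unfolding age_cone_def by blast
  have eq: "f + t *\<^sub>R g = exp_sum A (\<lambda>a. c a + t * d a)"
    by (auto simp: c d exp_sum_def plus_fun_def scaleR_fun_def distrib_right sum.distrib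
        sum_distrib_left mult.assoc)
  have "\<forall>x\<in>X. 0 \<le> (f + t *\<^sub>R g) x"
    using c d assms(3) by (auto simp: plus_fun_def scaleR_fun_def)
  moreover have "\<forall>a\<in>A - {b}. 0 \<le> c a + t * d a" using c(3) d(3) assms(3) by simp
  ultimately show ?thesis unfolding age_cone_def eq by blast
qed

lemma zero_in_age_cone: "0 \<in> age_cone X A b"
  unfolding age_cone_def by (auto intro!: exI[of _ "\<lambda>_. 0"] simp: exp_sum_def zero_fun_def)

section \<open>Slopes, generators and the cone they span\<close>

locale exponents =
  fixes m :: nat and \<alpha> :: "nat \<Rightarrow> real"
  assumes m3: "3 \<le> m" and mono: "strict_mono_on {1..m} \<alpha>"
begin

lemma alpha_less: "\<alpha> j < \<alpha> k" if "1 \<le> j" "j < k" "k \<le> m"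
  using mono that by (auto simp: strict_mono_on_def)

lemma alpha_inj: "inj_on \<alpha> {1..m}"
  using mono by (rule strict_mono_on_imp_inj_on)

definition slope :: "(nat \<Rightarrow> real) \<Rightarrow> nat \<Rightarrow> real" where
  "slope \<phi> j = (\<phi> (j + 1) - \<phi> j) / (\<alpha> (j + 1) - \<alpha> j)"

text \<open>With the missing slopes at both ends replaced by 0, the two-term and the three-term
  generators of the cone become instances of one formula.\<close>

definition slope_diff :: "(nat \<Rightarrow> real) \<Rightarrow> nat \<Rightarrow> real" where
  "slope_diff \<phi> j = (if j < m then slope \<phi> j else 0) - (if 1 < j then slope \<phi> (j - 1) else 0)"

text \<open>The parameter \<open>y\<close> is a zero: at \<open>x = y\<close> all the exponentials
  equal 1, and the slopes of a constant are 0.\<close>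

definition gen :: "nat \<Rightarrow> real \<Rightarrow> real \<Rightarrow> real" where
  "gen j y = (\<lambda>x. slope_diff (\<lambda>k. exp (\<alpha> k * (x - y))) j)"

text \<open>For the end indices \<open>gen\<close> is a single slope up to sign, which changes sign
  at \<open>y\<close>; it is non-negative on [-1,1] only if \<open>y\<close> is the matching
  endpoint.\<close>

definition admissible :: "nat \<Rightarrow> real \<Rightarrow> bool" where
  "admissible j y \<longleftrightarrow>
    j \<in> {1..m} \<and> y \<in> {-1..1} \<and> (j = 1 \<longrightarrow> y = -1) \<and> (j = m \<longrightarrow> y = 1)"

text \<open>The conic hull of the admissible generators, built one summand at a time so that rule
  induction applies.\<close>

inductive_set gen_cone :: "(real \<Rightarrow> real) set" where
  zero: "0 \<in> gen_cone"
| step: "f \<in> gen_cone \<Longrightarrow> 0 \<le> t \<Longrightarrow> admissible j y \<Longrightarrow> f + t *\<^sub>R gen j y \<in> gen_cone"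

lemma gen_cone_add: "f + g \<in> gen_cone" if "g \<in> gen_cone" "f \<in> gen_cone"
  using that
proof (induction g)
  case zero
  then show ?case by simp
next
  case (step g t j y)
  then have "(f + g) + t *\<^sub>R gen j y \<in> gen_cone" by (intro gen_cone.step)
  then show ?case by (simp only: add.assoc)
qed

lemma gen_cone_scaleR: "s *\<^sub>R f \<in> gen_cone" if "f \<in> gen_cone" "0 \<le> s"
  using that
proof (induction f)
  case zero
  show ?case by (simp only: scaleR_zero_right gen_cone.zero)
next
  case (step g t j y)
  then have "s *\<^sub>R g + (s * t) *\<^sub>R gen j y \<in> gen_cone" by (intro gen_cone.step) auto
  then show ?case by (simp only: scaleR_add_right scaleR_scaleR)
qed

lemma gen_in_gen_cone: "gen j y \<in> gen_cone" if "admissible j y"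
  using gen_cone.step[OF gen_cone.zero, of 1 j y] that by simp

text \<open>Admissibility is required only for non-zero coefficients, since at an interior
  \<open>y\<close> the end indices are never admissible.\<close>

lemma gen_sum_in_gen_cone:
  assumes "\<And>j. j \<in> {1..m} \<Longrightarrow> 0 \<le> r j"
    and "\<And>j. j \<in> {1..m} \<Longrightarrow> r j \<noteq> 0 \<Longrightarrow> admissible j y"
  shows "(\<lambda>x. \<Sum>j=1..m. r j * gen j y x) \<in> gen_cone"
proof -
  have "(\<lambda>x. \<Sum>j\<in>J. r j * gen j y x) \<in> gen_cone" if "finite J" "J \<subseteq> {1..m}" for J
    using that
  proof (induction J)
    case empty
    then show ?case using gen_cone.zero by (simp add: zero_fun_def)
  next
    case (insert j J)
    then have J: "(\<lambda>x. \<Sum>j\<in>J. r j * gen j y x) \<in> gen_cone" by simp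
    have "(\<lambda>x. \<Sum>j\<in>insert j J. r j * gen j y x)
        = (\<lambda>x. \<Sum>j\<in>J. r j * gen j y x) + r j *\<^sub>R gen j y"
      using insert by (auto simp: plus_fun_def scaleR_fun_def)
    then show ?case
      using J gen_cone.step[OF J, of "r j" j y] assms[of j] insert.prems by (cases "r j = 0") auto
  qed
  then show ?thesis by simp
qed

lemma gen_at_zero: "gen j y y = 0"
  by (simp add: gen_def slope_diff_def slope_def)

text \<open>For an inner index the tangent slope at \<open>\<alpha> j\<close> separates the two
  adjacent chord slopes strictly. For an end index \<open>x - y\<close> has a fixed sign on
  [-1,1].\<close>

lemma gen_pos:
  assumes "admissible j y" "x \<in> {-1..1}" "x \<noteq> y"
  shows "0 < gen j y x"
proof -
  let ?e = "\<lambda>k. exp (\<alpha> k * (x - y))"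
  consider "j = 1" "y = -1" | "j = m" "y = 1" | "1 < j" "j < m"
    using assms(1) by (fastforce simp: admissible_def)
  then show ?thesis
  proof cases
    case 1
    then have "\<alpha> 1 * (x - y) < \<alpha> 2 * (x - y)" using assms alpha_less[of 1 2] m3 by simp
    then show ?thesis using 1 m3 alpha_less[of 1 2]
      by (simp add: gen_def slope_diff_def slope_def numeral_2_eq_2)
  next
    case 2
    then have "\<alpha> m * (x - y) < \<alpha> (m - 1) * (x - y)"
      using assms alpha_less[of "m - 1" m] m3 by (simp add: mult_less_cancel_right)
    then show ?thesis using 2 m3 alpha_less[of "m - 1" m]
      by (simp add: gen_def slope_diff_def slope_def divide_less_0_iff)
  next
    case 3
    have "slope ?e (j - 1) < (x - y) * ?e j"
      using exp_slope_less[of "\<alpha> (j - 1)" "\<alpha> j" "x - y"] alpha_less[of "j - 1" j] assms 3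
      by (simp add: slope_def)
    also have "\<dots> < slope ?e j"
      using exp_slope_gt[of "\<alpha> j" "\<alpha> (j + 1)" "x - y"] alpha_less[of j "j + 1"] assms 3
      by (simp add: slope_def)
    finally show ?thesis using 3 by (simp add: gen_def slope_diff_def)
  qed
qed

lemma gen_nonneg: "0 \<le> gen j y x" if "admissible j y" "x \<in> {-1..1}"
  using gen_pos[OF that] gen_at_zero by (cases "x = y") (auto intro: less_imp_le)

lemma gen_cone_nonneg: "0 \<le> f x" if "f \<in> gen_cone" "x \<in> {-1..1}"
  using that by (induction f) (auto simp: plus_fun_def scaleR_fun_def gen_nonneg)

lemma gen_neq_zero: "gen j y \<noteq> 0" if "admissible j y"
proof
  assume "gen j y = 0"
  moreover obtain x :: real where "x \<in> {-1..1}" "x \<noteq> y"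
    by (cases "y = 0") (auto intro: that[of 0] that[of 1])
  ultimately show False using gen_pos[OF that, of x] by simp
qed

section \<open>The discrete Taylor formula\<close>

text \<open>The sum telescopes. By the zero slopes at both ends the full sum is 0, which leaves a
  free additive constant in the coefficients of any expansion in slope differences.\<close>

lemma sum_slope_diff: "(\<Sum>j=1..k. slope_diff \<phi> j) = (if k < m then slope \<phi> k else 0)"
  if "1 \<le> k" "k \<le> m"
  using that
  by (induction k rule: nat_induct_at_least) (use m3 in \<open>auto simp: slope_diff_def\<close>)

text \<open>Taylor expansion at \<open>\<alpha> 1\<close> with kernel
  \<open>max 0 (\<alpha> k - \<alpha> j)\<close>. Passing to \<open>Suc k\<close> raises the kernel
  by the gap for \<open>j \<le> k\<close> only, and the slope differences up to \<open>k\<close> add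
  up to \<open>slope \<phi> k\<close>.\<close>

lemma slope_diff_expansion:
  assumes "1 \<le> k" "k \<le> m"
  shows "\<phi> k = \<phi> 1 + (\<Sum>j=1..m. max 0 (\<alpha> k - \<alpha> j) * slope_diff \<phi> j)"
  using assms
proof (induction k rule: nat_induct_at_least)
  case base
  have "max 0 (\<alpha> 1 - \<alpha> j) = 0" if "j \<in> {1..m}" for j
    using alpha_less[of 1 j] that by (cases "j = 1") auto
  then show ?case by simp
next
  case (Suc k)
  have "max 0 (\<alpha> (Suc k) - \<alpha> j) - max 0 (\<alpha> k - \<alpha> j)
      = (if j \<le> k then \<alpha> (Suc k) - \<alpha> k else 0)" if "j \<in> {1..m}" for j
  proof -
    consider "j < k" | "j = k" | "j = Suc k" | "Suc k < j" by linarith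
    then show ?thesis
      by cases (use alpha_less[of j k] alpha_less[of k "Suc k"] alpha_less[of "Suc k" j] that Suc
          in auto)
  qed
  then have "(\<Sum>j=1..m. max 0 (\<alpha> (Suc k) - \<alpha> j) * slope_diff \<phi> j)
      - (\<Sum>j=1..m. max 0 (\<alpha> k - \<alpha> j) * slope_diff \<phi> j)
      = (\<Sum>j=1..m. (if j \<le> k then \<alpha> (Suc k) - \<alpha> k else 0) * slope_diff \<phi> j)"
    unfolding sum_subtractf[symmetric] left_diff_distrib[symmetric] by (intro sum.cong) auto
  also have "\<dots> = (\<Sum>j=1..k. (\<alpha> (Suc k) - \<alpha> k) * slope_diff \<phi> j)"
    using Suc by (intro sum.mono_neutral_cong_right) auto
  also have "\<dots> = (\<alpha> (Suc k) - \<alpha> k) * slope \<phi> k"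
    using Suc sum_slope_diff[of k \<phi>] by (simp flip: sum_distrib_left)
  also have "\<dots> = \<phi> (Suc k) - \<phi> k"
    using Suc alpha_less[of k "Suc k"] by (simp add: slope_def)
  finally show ?case using Suc by simp
qed

text \<open>Weights of sum zero cancel the constant term \<open>\<phi> 1\<close>. The shift
  \<open>C\<close> is free because the slope differences sum to zero.\<close>

lemma weighted_sum_eq_slope_diffs:
  assumes "(\<Sum>k=1..m. v k) = 0"
  shows "(\<Sum>k=1..m. v k * \<phi> k)
    = (\<Sum>j=1..m. ((\<Sum>k=1..m. v k * max 0 (\<alpha> k - \<alpha> j)) + C) * slope_diff \<phi> j)"
proof -
  have "(\<Sum>k=1..m. v k * \<phi> k)
      = (\<Sum>k=1..m. v k * \<phi> 1 + (\<Sum>j=1..m. v k * max 0 (\<alpha> k - \<alpha> j) * slope_diff \<phi> j))"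
  proof (intro sum.cong refl)
    fix k assume "k \<in> {1..m}"
    then show "v k * \<phi> k
        = v k * \<phi> 1 + (\<Sum>j=1..m. v k * max 0 (\<alpha> k - \<alpha> j) * slope_diff \<phi> j)"
      by (subst slope_diff_expansion[of k \<phi>])
        (auto simp: distrib_left sum_distrib_left mult.assoc)
  qed
  also have "\<dots> = (\<Sum>k=1..m. v k) * \<phi> 1
      + (\<Sum>j=1..m. (\<Sum>k=1..m. v k * max 0 (\<alpha> k - \<alpha> j)) * slope_diff \<phi> j)"
    unfolding sum.distrib sum_distrib_right by (subst (2) sum.swap) simp
  also have "\<dots> = (\<Sum>j=1..m. ((\<Sum>k=1..m. v k * max 0 (\<alpha> k - \<alpha> j)) + C) * slope_diff \<phi> j)"
    using assms sum_slope_diff[of m \<phi>] m3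
    by (simp add: distrib_right sum.distrib flip: sum_distrib_left)
  finally show ?thesis .
qed

section \<open>AGE functions are combinations of generators\<close>

text \<open>The first-order conditions on \<open>y\<close> are those of a minimiser over \<open>[-1, 1]\<close>. The two cases
  of the proof use the two shifts \<open>C\<close> in the previous lemma that keep all coefficients
  non-negative.\<close>

lemma single_negative_in_gen_cone:
  assumes y: "y \<in> {-1..1}" and i: "i \<in> {1..m}"
    and pos: "\<And>k. k \<in> {1..m} - {i} \<Longrightarrow> 0 \<le> v k"
    and zero: "(\<Sum>k=1..m. v k) = 0"
    and left: "y \<noteq> -1 \<Longrightarrow> (\<Sum>k=1..m. v k * \<alpha> k) \<le> 0"
    and right: "y \<noteq> 1 \<Longrightarrow> 0 \<le> (\<Sum>k=1..m. v k * \<alpha> k)"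
  shows "(\<lambda>x. \<Sum>k=1..m. v k * exp (\<alpha> k * (x - y))) \<in> gen_cone"
proof -
  define S where "S = (\<Sum>k=1..m. v k * \<alpha> k)"
  \<comment> \<open>\<open>t j\<close> sees only exponents above \<open>\<alpha> j\<close>, and
    \<open>u j\<close> only those below. The possibly negative \<open>v i\<close> therefore does not
    enter \<open>t j\<close> for \<open>j \<ge> i\<close>, nor \<open>u j\<close> for
    \<open>j \<le> i\<close>.\<close>
  define t where "t j = (\<Sum>k=1..m. v k * max 0 (\<alpha> k - \<alpha> j))" for j
  define u where "u j = (\<Sum>k=1..m. v k * max 0 (\<alpha> j - \<alpha> k))" for j
  have tu: "t j = u j + S" for j
  proof -
    have "t j - u j = (\<Sum>k=1..m. v k * (\<alpha> k - \<alpha> j))"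
      unfolding t_def u_def sum_subtractf[symmetric] right_diff_distrib[symmetric]
      by (intro sum.cong) auto
    also have "\<dots> = S" using zero
      by (simp add: right_diff_distrib sum_subtractf S_def flip: sum_distrib_right)
    finally show ?thesis by simp
  qed
  have le: "\<alpha> j \<le> \<alpha> k" if "j \<in> {1..m}" "j \<le> k" "k \<le> m" for j k
    using alpha_less[of j k] that by (cases "j = k") auto
  have t_pos: "0 \<le> t j" if "j \<in> {1..m}" "i \<le> j" for j
    unfolding t_def
  proof (intro sum_nonneg)
    fix k assume k: "k \<in> {1..m}"
    show "0 \<le> v k * max 0 (\<alpha> k - \<alpha> j)"
      using pos[of k] le[of k j] that k by (cases "k = i") auto
  qed
  have u_pos: "0 \<le> u j" if "j \<in> {1..m}" "j \<le> i" for j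
    unfolding u_def
  proof (intro sum_nonneg)
    fix k assume k: "k \<in> {1..m}"
    show "0 \<le> v k * max 0 (\<alpha> j - \<alpha> k)"
      using pos[of k] le[of j k] that k by (cases "k = i") auto
  qed
  have t_m: "t m = 0"
    unfolding t_def
  proof (intro sum.neutral ballI)
    fix k assume "k \<in> {1..m}"
    then show "v k * max 0 (\<alpha> k - \<alpha> m) = 0" using le[of k m] by simp
  qed
  have u_1: "u 1 = 0"
    unfolding u_def
  proof (intro sum.neutral ballI)
    fix k assume "k \<in> {1..m}"
    then show "v k * max 0 (\<alpha> 1 - \<alpha> k) = 0" using le[of 1 k] by simp
  qed
  \<comment> \<open>\<open>t\<close> and \<open>u\<close> differ by the constant \<open>S\<close>,
    so the sign of \<open>S\<close> tells which of them is non-negative at every index.\<close>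
  define r where "r j = (if 0 \<le> S then t j else u j)" for j
  have "(\<Sum>k=1..m. v k * exp (\<alpha> k * (x - y))) = (\<Sum>j=1..m. r j * gen j y x)" for x
  proof (cases "0 \<le> S")
    case True
    then show ?thesis
      using weighted_sum_eq_slope_diffs[OF zero, of "\<lambda>k. exp (\<alpha> k * (x - y))" 0]
      by (simp add: r_def t_def gen_def)
  next
    case False
    then show ?thesis
      using weighted_sum_eq_slope_diffs[OF zero, of "\<lambda>k. exp (\<alpha> k * (x - y))" "- S", folded t_def] tu
      by (simp add: r_def gen_def)
  qed
  moreover have "(\<lambda>x. \<Sum>j=1..m. r j * gen j y x) \<in> gen_cone"
  proof (rule gen_sum_in_gen_cone)
    fix j assume j: "j \<in> {1..m}"
    show "0 \<le> r j"
      using t_pos[OF j] u_pos[OF j] tu[of j] by (cases "i \<le> j") (auto simp: r_def)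
    assume nz: "r j \<noteq> 0"
    \<comment> \<open>Away from \<open>y = -1\<close> the first-order condition gives
      \<open>S \<le> 0\<close>, and then \<open>u 1 = 0\<close> makes \<open>r 1\<close> vanish in
      both branches. Index \<open>m\<close> is symmetric, with \<open>t m = 0\<close>.\<close>
    have "y = -1" if "j = 1"
    proof (rule ccontr)
      assume "y \<noteq> -1"
      then have "S \<le> 0" using left by (simp add: S_def)
      then have "r 1 = 0" using tu[of 1] u_1 by (simp add: r_def)
      then show False using nz that by simp
    qed
    moreover have "y = 1" if "j = m"
    proof (rule ccontr)
      assume "y \<noteq> 1"
      then have "0 \<le> S" using right by (simp add: S_def)
      then have "r m = 0" using t_m by (simp add: r_def)
      then show False using nz that by simp
    qed
    ultimately show "admissible j y" using j y by (simp add: admissible_def)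
  qed
  ultimately show ?thesis by presburger
qed

text \<open>With a second exponent \<open>\<alpha> l\<close>, two binomials that are non-negative on
  [-1,1] and vanish at opposite endpoints combine to a positive multiple of the exponential.\<close>

lemma exp_in_gen_cone:
  assumes i: "i \<in> {1..m}"
  shows "(\<lambda>x. exp (\<alpha> i * x)) \<in> gen_cone"
proof -
  define l :: nat where "l = (if i = 1 then 2 else 1)"
  have l: "l \<in> {1..m}" "l \<noteq> i" using m3 by (auto simp: l_def)
  then have "\<alpha> l \<noteq> \<alpha> i" using alpha_inj i by (auto dest: inj_onD)
  define y :: real where "y = sgn (\<alpha> l - \<alpha> i)"
  have y: "0 < (\<alpha> l - \<alpha> i) * y" "y = 1 \<and> \<alpha> i < \<alpha> l \<or> y = -1 \<and> \<alpha> l < \<alpha> i"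
    using \<open>\<alpha> l \<noteq> \<alpha> i\<close> by (auto simp: y_def sgn_if)
  have sums: "(\<Sum>k=1..m. (if k = a then 1 else if k = b then -1 else 0) * \<phi> k) = \<phi> a - \<phi> b"
    if "a \<in> {1..m}" "b \<in> {1..m}" "a \<noteq> b" for a b and \<phi> :: "nat \<Rightarrow> real"
  proof -
    have "(\<Sum>k=1..m. (if k = a then 1 else if k = b then -1 else 0) * \<phi> k)
        = (\<Sum>k=1..m. (if k = a then \<phi> k else 0) - (if k = b then \<phi> k else 0))"
      using that by (intro sum.cong) auto
    also have "\<dots> = \<phi> a - \<phi> b" using that by (simp add: sum_subtractf)
    finally show ?thesis .
  qed
  have diff: "(\<lambda>x. exp (\<alpha> a * (x - z)) - exp (\<alpha> b * (x - z))) \<in> gen_cone"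
    if "a \<in> {1..m}" "b \<in> {1..m}" "a \<noteq> b" "z = 1 \<and> \<alpha> a < \<alpha> b \<or> z = -1 \<and> \<alpha> b < \<alpha> a" for a b z
  proof -
    let ?v = "\<lambda>k. if k = a then 1 else if k = b then -1 else 0 :: real"
    have "(\<lambda>x. \<Sum>k=1..m. ?v k * exp (\<alpha> k * (x - z))) \<in> gen_cone"
    proof (rule single_negative_in_gen_cone[of z b])
      show "(\<Sum>k=1..m. ?v k) = 0" using sums[OF that(1-3), of "\<lambda>_. 1"] by simp
    qed (use that in \<open>auto simp only: sums[OF that(1-3)]\<close>, use that in \<open>auto split: if_splits\<close>)
    then show ?thesis unfolding sums[OF that(1-3)] .
  qed
  let ?p = "\<lambda>x. exp (\<alpha> i * (x - y)) - exp (\<alpha> l * (x - y))"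
  let ?q = "\<lambda>x. exp (\<alpha> l * (x + y)) - exp (\<alpha> i * (x + y))"
  \<comment> \<open>The factor \<open>\<kappa>\<close> cancels the term
    \<open>exp (\<alpha> l * x)\<close>. The remaining coefficient \<open>\<mu>\<close> is positive
    because \<open>y\<close> has the sign of \<open>\<alpha> l - \<alpha> i\<close>.\<close>
  define \<kappa> where "\<kappa> = exp (- (2 * \<alpha> l * y))"
  define \<mu> where "\<mu> = exp (- (\<alpha> i * y)) - exp (\<alpha> i * y - 2 * \<alpha> l * y)"
  have "\<mu> > 0" using y(1) by (simp add: \<mu>_def algebra_simps)
  have "?p \<in> gen_cone" using diff[of i l y] i l y by simp
  moreover have "?q \<in> gen_cone" using diff[of l i "- y"] i l y by auto
  ultimately have "(1 / \<mu>) *\<^sub>R (?p + \<kappa> *\<^sub>R ?q) \<in> gen_cone"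
    using \<open>\<mu> > 0\<close> by (intro gen_cone_scaleR gen_cone_add) (auto simp: \<kappa>_def)
  moreover have "(1 / \<mu>) *\<^sub>R (?p + \<kappa> *\<^sub>R ?q) = (\<lambda>x. exp (\<alpha> i * x))"
  proof
    fix x
    have "?p x + \<kappa> * ?q x = \<mu> * exp (\<alpha> i * x)"
      by (simp add: \<kappa>_def \<mu>_def right_diff_distrib left_diff_distrib flip: exp_add)
        (simp add: algebra_simps)
    then show "((1 / \<mu>) *\<^sub>R (?p + \<kappa> *\<^sub>R ?q)) x = exp (\<alpha> i * x)"
      using \<open>\<mu> > 0\<close> by (simp add: scaleR_fun_def plus_fun_def)
  qed
  ultimately show ?thesis by simp
qed

lemma exp_sum_alpha: "exp_sum (\<alpha> ` {1..m}) c x = (\<Sum>k=1..m. c (\<alpha> k) * exp (\<alpha> k * x))"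
  unfolding exp_sum_def sum.reindex[OF alpha_inj] o_def inner_real_def ..

lemma age_cone_subset_gen_cone:
  assumes i: "i \<in> {1..m}"
  shows "age_cone {-1..1} (\<alpha> ` {1..m}) (\<alpha> i) \<subseteq> gen_cone"
proof
  fix f assume "f \<in> age_cone {-1..1} (\<alpha> ` {1..m}) (\<alpha> i)"
  then obtain c where f: "f = exp_sum (\<alpha> ` {1..m}) c" and fpos: "\<forall>x\<in>{-1..1}. 0 \<le> f x"
    and cpos: "\<forall>a\<in>\<alpha> ` {1..m} - {\<alpha> i}. 0 \<le> c a"
    by (auto simp: age_cone_def)
  \<comment> \<open>After this division, subtracting the minimum affects only the coefficient at
    \<open>\<alpha> i\<close>, the one whose sign is free.\<close>
  define F where "F x = (\<Sum>k=1..m. c (\<alpha> k) * exp ((\<alpha> k - \<alpha> i) * x))" for x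
  have fF: "f x = exp (\<alpha> i * x) * F x" for x
    unfolding f exp_sum_alpha F_def sum_distrib_left
    by (intro sum.cong) (auto simp: algebra_simps simp flip: exp_add)
  have "continuous_on {-1..1} F" unfolding F_def by (intro continuous_intros)
  then obtain y where y: "y \<in> {-1..1}" and ymin: "\<And>x. x \<in> {-1..1} \<Longrightarrow> F y \<le> F x"
    using continuous_attains_inf[of "{-1..1::real}" F] by auto
  have "0 \<le> F y" using bspec[OF fpos y] fF[of y] by (simp add: zero_le_mult_iff)
  define D where "D = (\<Sum>k=1..m. c (\<alpha> k) * ((\<alpha> k - \<alpha> i) * exp ((\<alpha> k - \<alpha> i) * y)))"
  have deriv: "DERIV F y :> D"
    unfolding F_def[abs_def] D_def
    by (auto intro!: derivative_eq_intros sum.cong simp: mult_ac)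
  have left: "D \<le> 0" if "y \<noteq> -1"
  proof (rule ccontr)
    assume "\<not> D \<le> 0"
    then obtain d where "d > 0" and d: "\<And>h. h > 0 \<Longrightarrow> h < d \<Longrightarrow> F (y - h) < F y"
      using DERIV_pos_inc_left[OF deriv] by auto
    \<comment> \<open>The cap keeps \<open>y - h\<close> in [-1,1], where \<open>y\<close> is a
      minimiser.\<close>
    define h where "h = min (d / 2) (y + 1)"
    have "h > 0" "h < d" "h \<le> y + 1" using \<open>d > 0\<close> y that by (auto simp: h_def)
    then show False using d[of h] ymin[of "y - h"] y by auto
  qed
  have right: "0 \<le> D" if "y \<noteq> 1"
  proof (rule ccontr)
    assume "\<not> 0 \<le> D"
    then obtain d where "d > 0" and d: "\<And>h. h > 0 \<Longrightarrow> h < d \<Longrightarrow> F (y + h) < F y"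
      using DERIV_neg_dec_right[OF deriv] by auto
    define h where "h = min (d / 2) (1 - y)"
    have "h > 0" "h < d" "h \<le> 1 - y" using \<open>d > 0\<close> y that by (auto simp: h_def)
    then show False using d[of h] ymin[of "y + h"] y by auto
  qed
  \<comment> \<open>Coefficients of the remainder in the exponentials centred at \<open>y\<close>;
    they sum to zero because the remainder vanishes there.\<close>
  define v where "v k = (c (\<alpha> k) - (if k = i then F y else 0)) * exp (\<alpha> k * y)" for k
  have v_sum: "(\<Sum>k=1..m. v k * \<phi> k)
      = (\<Sum>k=1..m. c (\<alpha> k) * exp (\<alpha> k * y) * \<phi> k) - F y * exp (\<alpha> i * y) * \<phi> i" for \<phi>
  proof -
    have "(\<Sum>k=1..m. v k * \<phi> k) = (\<Sum>k=1..m. c (\<alpha> k) * exp (\<alpha> k * y) * \<phi> k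
        - (if k = i then F y * exp (\<alpha> k * y) * \<phi> k else 0))"
      by (intro sum.cong) (auto simp: v_def algebra_simps)
    also have "\<dots> = (\<Sum>k=1..m. c (\<alpha> k) * exp (\<alpha> k * y) * \<phi> k) - F y * exp (\<alpha> i * y) * \<phi> i"
      using i by (simp add: sum_subtractf)
    finally show ?thesis .
  qed
  have v0: "(\<Sum>k=1..m. v k) = 0"
    using v_sum[of "\<lambda>_. 1"] fF[of y] unfolding f exp_sum_alpha by simp
  \<comment> \<open>As the weights sum to zero, \<open>\<alpha> k\<close> may be replaced by
    \<open>\<alpha> k - \<alpha> i\<close>. The first moment is thus a positive multiple of the
    derivative of \<open>F\<close>.\<close>
  have v1: "(\<Sum>k=1..m. v k * \<alpha> k) = exp (\<alpha> i * y) * D"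
  proof -
    have "(\<Sum>k=1..m. v k * \<alpha> k) = (\<Sum>k=1..m. v k * (\<alpha> k - \<alpha> i))"
      using v0 by (simp add: right_diff_distrib sum_subtractf flip: sum_distrib_right)
    also have "\<dots> = exp (\<alpha> i * y) * D"
    proof -
      have "exp (\<alpha> i * y) * exp ((\<alpha> k - \<alpha> i) * y) = exp (\<alpha> k * y)" for k
        by (simp add: left_diff_distrib flip: exp_add)
      then have "c (\<alpha> k) * exp (\<alpha> k * y) * (\<alpha> k - \<alpha> i)
          = exp (\<alpha> i * y) * (c (\<alpha> k) * ((\<alpha> k - \<alpha> i) * exp ((\<alpha> k - \<alpha> i) * y)))" for k
        by (metis mult.assoc mult.commute)
      then show ?thesis unfolding v_sum D_def sum_distrib_left
        by (simp only: diff_self mult_zero_right diff_zero)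
    qed
    finally show ?thesis .
  qed
  have "(\<lambda>x. \<Sum>k=1..m. v k * exp (\<alpha> k * (x - y))) \<in> gen_cone"
  proof (rule single_negative_in_gen_cone[OF y i _ v0])
    fix k assume k: "k \<in> {1..m} - {i}"
    then have "\<alpha> k \<noteq> \<alpha> i" using inj_onD[OF alpha_inj, of k i] i by auto
    then show "0 \<le> v k" using cpos k by (simp add: v_def)
  qed (unfold v1, use left right in \<open>auto simp: mult_le_0_iff\<close>)
  then have "F y *\<^sub>R (\<lambda>x. exp (\<alpha> i * x))
      + (\<lambda>x. \<Sum>k=1..m. v k * exp (\<alpha> k * (x - y))) \<in> gen_cone"
    using exp_in_gen_cone[OF i] \<open>0 \<le> F y\<close> by (intro gen_cone_add gen_cone_scaleR)
  moreover have "(\<Sum>k=1..m. v k * exp (\<alpha> k * (x - y))) = f x - F y * exp (\<alpha> i * x)" for x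
    unfolding v_sum f exp_sum_alpha
    by (auto intro!: sum.cong simp: mult.assoc right_diff_distrib simp flip: exp_add)
  ultimately show "f \<in> gen_cone" by (simp add: scaleR_fun_def plus_fun_def)
qed

section \<open>Generators are AGE functions, and the two cones agree\<close>

text \<open>The values on unit vectors serve as the coefficients of \<open>gen\<close> with respect
  to the exponentials.\<close>

lemma slope_diff_linear:
  assumes "j \<in> {1..m}"
  shows "slope_diff \<phi> j = (\<Sum>k=1..m. slope_diff (\<lambda>l. if l = k then 1 else 0) j * \<phi> k)"
proof -
  have *: "slope \<phi> j = (\<Sum>k=1..m. slope (\<lambda>l. if l = k then 1 else 0) j * \<phi> k)"
    if "1 \<le> j" "j < m" for j
  proof -
    have "(\<Sum>k=1..m. slope (\<lambda>l. if l = k then 1 else 0) j * \<phi> k)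
      = (\<Sum>k=1..m. ((if j + 1 = k then \<phi> k else 0) - (if j = k then \<phi> k else 0))
          / (\<alpha> (j + 1) - \<alpha> j))"
      by (intro sum.cong) (auto simp: slope_def)
    also have "\<dots> = slope \<phi> j"
      using that by (simp add: slope_def sum_subtractf flip: sum_divide_distrib)
    finally show ?thesis by simp
  qed
  show ?thesis
    using assms *[of j] *[of "j - 1"] unfolding slope_diff_def
    by (auto simp: left_diff_distrib sum_subtractf sum_negf)
qed

lemma gen_eq_exp_sum:
  assumes "j \<in> {1..m}"
  shows "gen j y x
    = (\<Sum>k=1..m. slope_diff (\<lambda>l. if l = k then 1 else 0) j * exp (- (\<alpha> k * y)) * exp (\<alpha> k * x))"
  unfolding gen_def slope_diff_linear[OF assms, of "\<lambda>k. exp (\<alpha> k * (x - y))"]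
  by (intro sum.cong) (auto simp: algebra_simps simp flip: exp_add)

text \<open>In a difference of adjacent slopes only the central value \<open>\<phi> j\<close> has a
  negative coefficient.\<close>

lemma gen_in_age_cone:
  assumes "admissible j y"
  shows "gen j y \<in> age_cone {-1..1} (\<alpha> ` {1..m}) (\<alpha> j)"
proof -
  have j: "j \<in> {1..m}" using assms by (simp add: admissible_def)
  define w where "w k = slope_diff (\<lambda>l. if l = k then 1 else 0) j * exp (- (\<alpha> k * y))" for k
  \<comment> \<open>Transports coefficients from indices to exponents, the index set of
    \<open>exp_sum\<close>.\<close>
  define c where "c = w \<circ> inv_into {1..m} \<alpha>"
  have c: "c (\<alpha> k) = w k" if "k \<in> {1..m}" for k
    using that alpha_inj by (simp add: c_def)
  have eq: "gen j y = exp_sum (\<alpha> ` {1..m}) c"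
  proof
    fix x
    show "gen j y x = exp_sum (\<alpha> ` {1..m}) c x"
      unfolding exp_sum_alpha gen_eq_exp_sum[OF j] by (intro sum.cong) (auto simp: c w_def)
  qed
  have "0 \<le> w k" if "k \<in> {1..m}" "k \<noteq> j" for k
    using that j alpha_less[of "j - 1" j] alpha_less[of j "Suc j"]
    by (auto simp: w_def slope_diff_def slope_def)
  then have "\<forall>a\<in>\<alpha> ` {1..m} - {\<alpha> j}. 0 \<le> c a" using c by (metis DiffE image_iff singletonI)
  then show ?thesis
    using eq gen_nonneg[OF assms] unfolding age_cone_def by auto
qed

lemma sage_cone_eq_gen_cone: "sage_cone {-1..1} (\<alpha> ` {1..m}) = gen_cone" (is "?C = _")
proof
  let ?age = "age_cone {-1..1} (\<alpha> ` {1..m})"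
  have C: "?C = {sum s (\<alpha> ` {1..m}) | s. \<forall>b\<in>\<alpha> ` {1..m}. s b \<in> ?age b}"
    unfolding sage_cone_def by (rule set_sum_alt) simp
  show "?C \<subseteq> gen_cone"
  proof
    fix f assume "f \<in> ?C"
    then obtain s where f: "f = sum s (\<alpha> ` {1..m})" and s: "\<forall>b\<in>\<alpha> ` {1..m}. s b \<in> ?age b"
      unfolding C by blast
    have "sum s B \<in> gen_cone" if "finite B" "B \<subseteq> \<alpha> ` {1..m}" for B
      using that
    proof (induction B)
      case empty
      show ?case by (simp only: sum.empty gen_cone.zero)
    next
      case (insert b B)
      then have "s b \<in> gen_cone" using s age_cone_subset_gen_cone by blast
      moreover have "sum s B \<in> gen_cone" using insert by simp
      ultimately show ?case
        unfolding sum.insert[OF insert.hyps(1,2)] by (intro gen_cone_add)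
    qed
    then show "f \<in> gen_cone" using f by simp
  qed
  show "gen_cone \<subseteq> ?C"
  proof
    fix f assume "f \<in> gen_cone"
    then show "f \<in> ?C"
    proof (induction f)
      case zero
      show ?case unfolding C using zero_in_age_cone by (auto intro!: exI[of _ "\<lambda>_. 0"])
    next
      case (step f t j y)
      then obtain s where f: "f = sum s (\<alpha> ` {1..m})" and s: "\<forall>b\<in>\<alpha> ` {1..m}. s b \<in> ?age b"
        unfolding C by blast
      \<comment> \<open>The new generator is absorbed by the summand of its own exponent.\<close>
      define s' where "s' b = s b + (if b = \<alpha> j then t *\<^sub>R gen j y else 0)" for b
      have j: "\<alpha> j \<in> \<alpha> ` {1..m}" using step by (simp add: admissible_def)
      have "sum s' (\<alpha> ` {1..m}) = f + t *\<^sub>R gen j y"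
        using j unfolding s'_def sum.distrib f by simp
      moreover have "\<forall>b\<in>\<alpha> ` {1..m}. s' b \<in> ?age b"
        using s age_cone_convex_cone[OF bspec[OF s j] gen_in_age_cone] step by (simp add: s'_def)
      ultimately show ?case unfolding C by (auto intro!: exI[of _ s'])
    qed
  qed
qed

section \<open>Linear relations between generators, and extremality\<close>

text \<open>By independence of the exponentials, the relation holds for the slope differences of
  every \<open>\<phi>\<close>, so test sequences can be inserted.\<close>

lemma gen_relation_const:
  assumes rel: "\<And>x. (\<Sum>j=1..m. s j * gen j y x) = 0" and i: "1 \<le> i" "i < m"
  shows "s i = s (Suc i)"
proof -
  define w where "w k = (\<Sum>j=1..m. s j * slope_diff (\<lambda>l. if l = k then 1 else 0) j)" for k
  have w_sum: "(\<Sum>j=1..m. s j * slope_diff \<phi> j) = (\<Sum>k=1..m. w k * \<phi> k)" for \<phi>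
  proof -
    have "(\<Sum>j=1..m. s j * slope_diff \<phi> j)
        = (\<Sum>j=1..m. \<Sum>k=1..m. s j * slope_diff (\<lambda>l. if l = k then 1 else 0) j * \<phi> k)"
    proof (intro sum.cong refl)
      fix j assume "j \<in> {1..m}"
      then show "s j * slope_diff \<phi> j
          = (\<Sum>k=1..m. s j * slope_diff (\<lambda>l. if l = k then 1 else 0) j * \<phi> k)"
        by (subst slope_diff_linear) (simp_all add: sum_distrib_left mult.assoc)
    qed
    also have "\<dots> = (\<Sum>k=1..m. w k * \<phi> k)"
      unfolding w_def sum_distrib_right by (rule sum.swap)
    finally show ?thesis .
  qed
  define c where "c = (\<lambda>k. w k * exp (- (\<alpha> k * y))) \<circ> inv_into {1..m} \<alpha>"
  have c: "c (\<alpha> k) = w k * exp (- (\<alpha> k * y))" if "k \<in> {1..m}" for k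
    using that alpha_inj by (simp add: c_def)
  have "(\<Sum>a\<in>\<alpha> ` {1..m}. c a * exp (a * x)) = 0" for x
  proof -
    have "(\<Sum>a\<in>\<alpha> ` {1..m}. c a * exp (a * x)) = (\<Sum>k=1..m. w k * exp (\<alpha> k * (x - y)))"
      unfolding sum.reindex[OF alpha_inj] o_def
      by (intro sum.cong) (auto simp: c algebra_simps simp flip: exp_add)
    also have "\<dots> = 0" using rel[of x] unfolding gen_def w_sum .
    finally show ?thesis .
  qed
  from exp_sum_coeffs_zero[OF _ this] have "w k = 0" if "k \<in> {1..m}" for k
    using that c by force
  then have zero: "(\<Sum>j=1..m. s j * slope_diff \<phi> j) = 0" for \<phi>
    unfolding w_sum by simp
  \<comment> \<open>This jump has slope 1 between \<open>i\<close> and \<open>Suc i\<close> and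
    slope 0 elsewhere, so it isolates \<open>s i - s (Suc i)\<close>.\<close>
  define \<phi> :: "nat \<Rightarrow> real" where "\<phi> k = (if i < k then \<alpha> (Suc i) - \<alpha> i else 0)" for k
  have "slope \<phi> j = (if j = i then 1 else 0)" for j
    using alpha_less[of i "Suc i"] i by (auto simp: slope_def \<phi>_def)
  then have "s j * slope_diff \<phi> j = (if j = i then s i else 0) - (if j = Suc i then s (Suc i) else 0)"
    if "j \<in> {1..m}" for j
    using that i by (auto simp: slope_diff_def)
  then have "(\<Sum>j=1..m. s j * slope_diff \<phi> j)
      = (\<Sum>j=1..m. (if j = i then s i else 0) - (if j = Suc i then s (Suc i) else 0))"
    by (intro sum.cong) auto
  also have "\<dots> = s i - s (Suc i)" using i by (simp add: sum_subtractf)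
  finally show ?thesis using zero[of \<phi>] by simp
qed

text \<open>All coefficients of a relation are equal, so a vanishing end coefficient makes all of
  them vanish.\<close>

lemma gen_relation_zero:
  assumes rel: "\<And>x. (\<Sum>j=1..m. s j * gen j y x) = 0"
    and "s 1 = 0 \<or> s m = 0" and "j \<in> {1..m}"
  shows "s j = 0"
proof -
  have "s k = s 1" if "1 \<le> k" "k \<le> m" for k
    using that
    by (induction k rule: nat_induct_at_least) (use gen_relation_const[OF rel] in auto)
  then show ?thesis using assms m3 by (metis atLeastAtMost_iff le_trans one_le_numeral order_refl)
qed

text \<open>All summands are non-negative at \<open>y\<close>, hence each is zero there. By strict
  positivity elsewhere, a generator with non-zero coefficient has its zero at
  \<open>y\<close>.\<close>

lemma gen_cone_vanishing:
  assumes "f \<in> gen_cone" "f y = 0" "y \<in> {-1..1}"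
  shows "\<exists>s. f = (\<lambda>x. \<Sum>j=1..m. s j * gen j y x)
    \<and> (\<forall>j\<in>{1..m}. 0 \<le> s j \<and> (s j \<noteq> 0 \<longrightarrow> admissible j y))"
  using assms
proof (induction f)
  case zero
  show ?case by (rule exI[of _ "\<lambda>_. 0"]) (simp add: zero_fun_def)
next
  case (step f t j z)
  have "0 \<le> f y" "0 \<le> t * gen j z y"
    using step gen_cone_nonneg gen_nonneg by auto
  moreover have "f y + t * gen j z y = 0"
    using step.prems by (simp add: plus_fun_def scaleR_fun_def)
  ultimately have "f y = 0" and *: "t * gen j z y = 0" by linarith+
  then obtain s where f: "f = (\<lambda>x. \<Sum>j=1..m. s j * gen j y x)"
    and s: "\<forall>j\<in>{1..m}. 0 \<le> s j \<and> (s j \<noteq> 0 \<longrightarrow> admissible j y)"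
    using step by blast
  show ?case
  proof (cases "t = 0")
    case True
    then show ?thesis using f s by auto
  next
    case False
    then have "z = y" using * gen_pos[of j z y] step by force
    have j: "j \<in> {1..m}" using step by (simp add: admissible_def)
    have "f + t *\<^sub>R gen j z
        = (\<lambda>x. \<Sum>k=1..m. (s k + (if k = j then t else 0)) * gen k y x)"
      using j unfolding f \<open>z = y\<close>
      by (auto simp: plus_fun_def scaleR_fun_def distrib_right sum.distrib if_distrib[of "\<lambda>r. r * _"]
          cong: if_cong)
    then show ?thesis
      using s step \<open>z = y\<close> by (intro exI[of _ "\<lambda>k. s k + (if k = j then t else 0)"]) auto
  qed
qed

lemma gen_indecomposable:
  assumes adm: "admissible i y" and ab: "a \<in> gen_cone" "b \<in> gen_cone"
    and sum: "a + b = t *\<^sub>R gen i y"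
  shows "a \<in> ray (gen i y)"
proof -
  have y: "y \<in> {-1..1}" and i: "i \<in> {1..m}" using adm by (auto simp: admissible_def)
  have sum_x: "a x + b x = t * gen i y x" for x
    using fun_cong[OF sum, of x] by (simp add: plus_fun_def scaleR_fun_def)
  have "a y = 0" "b y = 0"
    using sum_x[of y] gen_cone_nonneg[OF ab(1) y] gen_cone_nonneg[OF ab(2) y]
    by (auto simp: gen_at_zero)
  obtain s where a: "a = (\<lambda>x. \<Sum>j=1..m. s j * gen j y x)"
    and s: "\<And>j. j \<in> {1..m} \<Longrightarrow> 0 \<le> s j \<and> (s j \<noteq> 0 \<longrightarrow> admissible j y)"
    using gen_cone_vanishing[OF ab(1) \<open>a y = 0\<close> y] by blast
  obtain s' where b: "b = (\<lambda>x. \<Sum>j=1..m. s' j * gen j y x)"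
    and s': "\<And>j. j \<in> {1..m} \<Longrightarrow> 0 \<le> s' j \<and> (s' j \<noteq> 0 \<longrightarrow> admissible j y)"
    using gen_cone_vanishing[OF ab(2) \<open>b y = 0\<close> y] by blast
  define r where "r j = s j + s' j - (if j = i then t else 0)" for j
  have "(\<Sum>j=1..m. r j * gen j y x) = a x + b x - t * gen i y x" for x
    using i unfolding a b r_def
    by (simp add: left_diff_distrib distrib_right sum.distrib sum_subtractf
        if_distrib[of "\<lambda>r. r * _"] cong: if_cong)
  then have rel: "(\<Sum>j=1..m. r j * gen j y x) = 0" for x using sum_x by simp
  \<comment> \<open>\<open>y\<close> cannot be both -1 and 1, so one end generator is absent. This
    makes the coefficients unique, and non-negativity of \<open>s\<close> and \<open>s'\<close>
    leaves only index \<open>i\<close>.\<close>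
  have "\<not> admissible 1 y \<or> \<not> admissible m y" using m3 by (auto simp: admissible_def)
  then have "r 1 = 0 \<or> r m = 0"
    using s[of 1] s'[of 1] s[of m] s'[of m] adm m3 by (auto simp: r_def)
  note r = gen_relation_zero[OF rel this]
  have "s j = 0" if "j \<in> {1..m}" "j \<noteq> i" for j
    using r[of j] s[of j] s'[of j] that by (simp add: r_def)
  then have "a x = s i * gen i y x" for x
    unfolding a using i by (subst sum.remove[of _ i]) auto
  then have "a = s i *\<^sub>R gen i y" by (auto simp: scaleR_fun_def)
  then show ?thesis using s[OF i] by (auto simp: ray_def)
qed

lemma extremal_ray_iff:
  "extremal_ray gen_cone R \<longleftrightarrow> (\<exists>j y. admissible j y \<and> R = ray (gen j y))"
proof
  assume "extremal_ray gen_cone R"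
  then obtain v where "v \<noteq> 0" and R: "R = ray v" and face: "ray v face_of gen_cone"
    by (auto simp: extremal_ray_def)
  have dest: "a \<in> ray v" if "a \<in> gen_cone" "b \<in> gen_cone" "a + b \<in> ray v" for a b
    using ray_face_of_coneD[OF face that] gen_cone_scaleR by simp
  have "v \<in> gen_cone" using face face_of_imp_subset self_in_ray by blast
  \<comment> \<open>Peeling summands off a non-zero point of the ray: the last one with
    \<open>t \<noteq> 0\<close> lies on the ray by the face property and so spans it.\<close>
  moreover have "\<exists>j y. admissible j y \<and> ray v = ray (gen j y)"
    if "f \<in> gen_cone" "f \<in> ray v" "f \<noteq> 0" for f
    using that
  proof (induction f)
    case zero
    then show ?case by simp
  next
    case (step f t j y)
    have g: "t *\<^sub>R gen j y \<in> gen_cone"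
      using step gen_in_gen_cone gen_cone_scaleR by blast
    show ?case
    proof (cases "t = 0")
      case True
      then show ?thesis using step by simp
    next
      case False
      have "t *\<^sub>R gen j y \<in> ray v" using dest[OF g step(1)] step.prems by (simp add: add.commute)
      moreover have "t *\<^sub>R gen j y \<noteq> 0" using False gen_neq_zero step by simp
      ultimately have "ray (t *\<^sub>R gen j y) = ray v" by (rule ray_eqI)
      then show ?thesis using ray_scaleR[of t "gen j y"] False step by auto
    qed
  qed
  ultimately show "\<exists>j y. admissible j y \<and> R = ray (gen j y)"
    using self_in_ray \<open>v \<noteq> 0\<close> R by metis
next
  assume "\<exists>j y. admissible j y \<and> R = ray (gen j y)"
  then obtain j y where adm: "admissible j y" and R: "R = ray (gen j y)" by blast
  \<comment> \<open>Indecomposability is applied to the scaled endpoints, whose plain sum is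
    \<open>x\<close>; the factor \<open>1 - u\<close> is then removed within the ray.\<close>
  have in_ray: "a \<in> ray (gen j y)"
    if ab: "a \<in> gen_cone" "b \<in> gen_cone" and x: "x \<in> ray (gen j y)"
      and u: "0 < u" "u < 1" "x = (1 - u) *\<^sub>R a + u *\<^sub>R b" for a b x u
  proof -
    obtain t where "x = t *\<^sub>R gen j y" using x by (auto simp: ray_def)
    then have "(1 - u) *\<^sub>R a \<in> ray (gen j y)"
      using gen_indecomposable[OF adm, of "(1 - u) *\<^sub>R a" "u *\<^sub>R b" t] gen_cone_scaleR ab u
      by simp
    then show ?thesis using scaleR_in_ray[of "(1 - u) *\<^sub>R a" _ "1 / (1 - u)"] u by simp
  qed
  have "ray (gen j y) face_of gen_cone"
    unfolding face_of_def
  proof (intro conjI ballI impI)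
    show "ray (gen j y) \<subseteq> gen_cone"
      using gen_in_gen_cone[OF adm] gen_cone_scaleR by (auto simp: ray_def)
    show "convex (ray (gen j y))" by (rule convex_ray)
    fix a b x
    assume *: "a \<in> gen_cone" "b \<in> gen_cone" "x \<in> ray (gen j y)" "x \<in> open_segment a b"
    then obtain u where u: "0 < u" "u < 1" "x = (1 - u) *\<^sub>R a + u *\<^sub>R b"
      by (auto simp: in_segment)
    then show "a \<in> ray (gen j y)" using in_ray * by blast
    show "b \<in> ray (gen j y)" using in_ray[of b a x "1 - u"] * u by (simp add: add.commute)
  qed
  then show "extremal_ray gen_cone R"
    using gen_neq_zero[OF adm] R by (auto simp: extremal_ray_def)
qed

section \<open>The explicit form of the generators\<close>

lemma ray_gen_first:
  "ray (gen 1 (-1)) = ray (\<lambda>x. exp (\<alpha> 2 * x) - exp (\<alpha> 1 - \<alpha> 2) * exp (\<alpha> 1 * x))"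
proof -
  have less: "\<alpha> 1 < \<alpha> 2" using alpha_less[of 1 2] m3 by simp
  have "gen 1 (-1) = (exp (\<alpha> 2) / (\<alpha> 2 - \<alpha> 1))
      *\<^sub>R (\<lambda>x. exp (\<alpha> 2 * x) - exp (\<alpha> 1 - \<alpha> 2) * exp (\<alpha> 1 * x))"
  proof
    fix x
    have "exp (\<alpha> 2 * (x + 1)) - exp (\<alpha> 1 * (x + 1))
      = exp (\<alpha> 2) * (exp (\<alpha> 2 * x) - exp (\<alpha> 1 - \<alpha> 2) * exp (\<alpha> 1 * x))"
      by (simp add: right_diff_distrib flip: exp_add) (simp only: distrib_left mult_1_right add.commute)
    then show "gen 1 (-1) x = ((exp (\<alpha> 2) / (\<alpha> 2 - \<alpha> 1))
      *\<^sub>R (\<lambda>x. exp (\<alpha> 2 * x) - exp (\<alpha> 1 - \<alpha> 2) * exp (\<alpha> 1 * x))) x"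
      using m3 by (simp add: gen_def slope_diff_def slope_def scaleR_fun_def numeral_2_eq_2)
  qed
  then show ?thesis using less by (simp add: ray_scaleR)
qed

lemma ray_gen_last:
  "ray (gen m 1) = ray (\<lambda>x. exp (\<alpha> (m - 1) * x) - exp (\<alpha> (m - 1) - \<alpha> m) * exp (\<alpha> m * x))"
proof -
  have less: "\<alpha> (m - 1) < \<alpha> m" using alpha_less[of "m - 1" m] m3 by simp
  have "gen m 1 = (exp (- \<alpha> (m - 1)) / (\<alpha> m - \<alpha> (m - 1)))
      *\<^sub>R (\<lambda>x. exp (\<alpha> (m - 1) * x) - exp (\<alpha> (m - 1) - \<alpha> m) * exp (\<alpha> m * x))"
  proof
    fix x
    have "exp (\<alpha> (m - 1) * (x - 1)) - exp (\<alpha> m * (x - 1))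
      = exp (- \<alpha> (m - 1)) * (exp (\<alpha> (m - 1) * x) - exp (\<alpha> (m - 1) - \<alpha> m) * exp (\<alpha> m * x))"
      by (simp add: right_diff_distrib flip: exp_add)
    then have "exp (\<alpha> m * (x - 1)) - exp (\<alpha> (m - 1) * (x - 1))
      = - (exp (- \<alpha> (m - 1)) * (exp (\<alpha> (m - 1) * x) - exp (\<alpha> (m - 1) - \<alpha> m) * exp (\<alpha> m * x)))"
      by linarith
    then show "gen m 1 x = ((exp (- \<alpha> (m - 1)) / (\<alpha> m - \<alpha> (m - 1)))
      *\<^sub>R (\<lambda>x. exp (\<alpha> (m - 1) * x) - exp (\<alpha> (m - 1) - \<alpha> m) * exp (\<alpha> m * x))) x"
      using m3 by (simp add: gen_def slope_diff_def slope_def scaleR_fun_def)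
  qed
  then show ?thesis using less by (simp add: ray_scaleR)
qed

text \<open>For gaps \<open>p\<close> and \<open>q\<close> the difference of the two slopes is the
  weighted mean of the outer values minus the middle value, times
  \<open>(p + q) / (p * q)\<close>.\<close>

lemma ray_gen_middle:
  assumes i: "i \<in> {2..m - 1}" and "0 < \<kappa>"
    and f: "f = (\<lambda>x. \<kappa> * ((\<alpha> (i + 1) - \<alpha> i) / (\<alpha> (i + 1) - \<alpha> (i - 1)) * exp (\<alpha> (i - 1) * (x - y))
      - exp (\<alpha> i * (x - y))
      + (\<alpha> i - \<alpha> (i - 1)) / (\<alpha> (i + 1) - \<alpha> (i - 1)) * exp (\<alpha> (i + 1) * (x - y))))"
  shows "ray f = ray (gen i y)"
proof -
  define p where "p = \<alpha> i - \<alpha> (i - 1)"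
  define q where "q = \<alpha> (i + 1) - \<alpha> i"
  have pq: "0 < p" "0 < q" "\<alpha> (i + 1) - \<alpha> (i - 1) = p + q"
    using i alpha_less[of "i - 1" i] alpha_less[of i "i + 1"] by (auto simp: p_def q_def)
  have stencil: "(C - B) / q - (B - A) / p = (p + q) / (p * q) * (q / (p + q) * A - B + p / (p + q) * C)"
    for A B C :: real
  proof -
    have c: "(p + q) / (p * q) * (q / (p + q)) = 1 / p" "(p + q) / (p * q) * (p / (p + q)) = 1 / q"
      using pq(1,2) by simp_all
    have b: "(p + q) / (p * q) = 1 / p + 1 / q"
      using pq(1,2) by (simp add: add_divide_distrib)
    have "(p + q) / (p * q) * (q / (p + q) * A - B + p / (p + q) * C)
        = (p + q) / (p * q) * (q / (p + q)) * A - (p + q) / (p * q) * B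
          + (p + q) / (p * q) * (p / (p + q)) * C"
      by (simp only: distrib_left right_diff_distrib mult.assoc)
    also have "\<dots> = (C - B) / q - (B - A) / p"
      unfolding c unfolding b by (simp add: diff_divide_distrib algebra_simps)
    finally show ?thesis by (rule sym)
  qed
  have "i < m" "1 < i" using i by auto
  then have g: "gen i y x = (exp (\<alpha> (i + 1) * (x - y)) - exp (\<alpha> i * (x - y))) / q
      - (exp (\<alpha> i * (x - y)) - exp (\<alpha> (i - 1) * (x - y))) / p" for x
    by (simp add: gen_def slope_diff_def slope_def p_def q_def)
  have "gen i y = ((p + q) / (p * q) / \<kappa>) *\<^sub>R f"
  proof
    fix x
    show "gen i y x = (((p + q) / (p * q) / \<kappa>) *\<^sub>R f) x"
      unfolding g stencil f scaleR_fun_def pq(3) p_def[symmetric] q_def[symmetric]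
      using \<open>0 < \<kappa>\<close> by simp
  qed
  then show ?thesis using pq \<open>0 < \<kappa>\<close> by (simp add: ray_scaleR)
qed

text \<open>The zero \<open>y\<close> is the point of equality in the weighted AM-GM inequality for the two
  positive terms.\<close>

lemma middle_term_eq_gen:
  assumes i: "i \<in> {2..m - 1}" and pos: "0 < c\<^sub>1" "0 < c\<^sub>3"
    and l: "l\<^sub>1 = (\<alpha> (i + 1) - \<alpha> i) / (\<alpha> (i + 1) - \<alpha> (i - 1))"
      "l\<^sub>3 = (\<alpha> i - \<alpha> (i - 1)) / (\<alpha> (i + 1) - \<alpha> (i - 1))"
    and c\<^sub>2: "c\<^sub>2 = - ((c\<^sub>1 / l\<^sub>1) powr l\<^sub>1 * (c\<^sub>3 / l\<^sub>3) powr l\<^sub>3)"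
    and y: "y = ln ((c\<^sub>1 * l\<^sub>3) / (c\<^sub>3 * l\<^sub>1)) / (\<alpha> (i + 1) - \<alpha> (i - 1))"
  shows "ray (\<lambda>x. c\<^sub>1 * exp (\<alpha> (i - 1) * x) + c\<^sub>2 * exp (\<alpha> i * x) + c\<^sub>3 * exp (\<alpha> (i + 1) * x))
    = ray (gen i y)"
proof -
  have less: "\<alpha> (i - 1) < \<alpha> i" "\<alpha> i < \<alpha> (i + 1)"
    using i alpha_less[of "i - 1" i] alpha_less[of i "i + 1"] by auto
  then have lpos: "0 < l\<^sub>1" "0 < l\<^sub>3" and l_sum: "l\<^sub>1 + l\<^sub>3 = 1"
    and l_mean: "l\<^sub>1 * \<alpha> (i - 1) + l\<^sub>3 * \<alpha> (i + 1) = \<alpha> i"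
    unfolding l by (simp_all add: divide_simps) (simp_all add: algebra_simps)
  \<comment> \<open>The common logarithm at \<open>y\<close> of the two outer terms divided by their
    weights; \<open>y\<close> is the point where they agree.\<close>
  define L where "L = ln (c\<^sub>1 / l\<^sub>1) + \<alpha> (i - 1) * y"
  have "ln ((c\<^sub>1 * l\<^sub>3) / (c\<^sub>3 * l\<^sub>1)) = ln (c\<^sub>1 / l\<^sub>1) - ln (c\<^sub>3 / l\<^sub>3)"
    using pos lpos by (simp add: ln_div ln_mult)
  then have "ln (c\<^sub>1 / l\<^sub>1) - ln (c\<^sub>3 / l\<^sub>3) = (\<alpha> (i + 1) - \<alpha> (i - 1)) * y"
    using y less by simp
  then have ln1: "ln (c\<^sub>1 / l\<^sub>1) = L - \<alpha> (i - 1) * y" and ln3: "ln (c\<^sub>3 / l\<^sub>3) = L - \<alpha> (i + 1) * y"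
    by (simp_all add: L_def algebra_simps)
  have c1: "c\<^sub>1 = l\<^sub>1 * exp (L - \<alpha> (i - 1) * y)" and c3: "c\<^sub>3 = l\<^sub>3 * exp (L - \<alpha> (i + 1) * y)"
    unfolding ln1[symmetric] ln3[symmetric] using pos lpos by simp_all
  have "c\<^sub>2 = - exp (l\<^sub>1 * ln (c\<^sub>1 / l\<^sub>1) + l\<^sub>3 * ln (c\<^sub>3 / l\<^sub>3))"
    using pos lpos unfolding c\<^sub>2 powr_def by (simp add: exp_add)
  also have "l\<^sub>1 * ln (c\<^sub>1 / l\<^sub>1) + l\<^sub>3 * ln (c\<^sub>3 / l\<^sub>3)
      = (l\<^sub>1 + l\<^sub>3) * L - (l\<^sub>1 * \<alpha> (i - 1) + l\<^sub>3 * \<alpha> (i + 1)) * y"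
    unfolding ln1 ln3 by (simp add: algebra_simps)
  \<comment> \<open>The weights sum to 1 and average the outer exponents to
    \<open>\<alpha> i\<close>, so the geometric mean is one exponential.\<close>
  finally have c2: "c\<^sub>2 = - exp (L - \<alpha> i * y)" unfolding l_sum l_mean by simp
  have shift: "exp (L - a * y) * exp (a * x) = exp L * exp (a * (x - y))" for a x
    by (simp add: algebra_simps flip: exp_add)
  have "c\<^sub>1 * exp (\<alpha> (i - 1) * x) + c\<^sub>2 * exp (\<alpha> i * x) + c\<^sub>3 * exp (\<alpha> (i + 1) * x)
    = exp L * (l\<^sub>1 * exp (\<alpha> (i - 1) * (x - y)) - exp (\<alpha> i * (x - y))
      + l\<^sub>3 * exp (\<alpha> (i + 1) * (x - y)))" for x
    unfolding c1 c2 c3 mult.assoc mult_minus_left shift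
    by (simp add: distrib_left right_diff_distrib mult.left_commute)
  then show ?thesis
    by (intro ray_gen_middle[OF i, of "exp L", folded l]) simp_all
qed

end

theorem theorem6p6:
  fixes m :: nat and \<alpha> :: "nat \<Rightarrow> real"
  assumes "m \<ge> 3"
    and "strict_mono_on {1..m} \<alpha>"
  shows "{R. extremal_ray (sage_cone {-1..1} (\<alpha> ` {1..m})) R} =
    {ray (\<lambda>x. exp (\<alpha> 2 * x) - exp (\<alpha> 1 - \<alpha> 2) * exp (\<alpha> 1 * x))} \<union>
    {ray (\<lambda>x. exp (\<alpha> (m - 1) * x) - exp (\<alpha> (m - 1) - \<alpha> m) * exp (\<alpha> m * x))} \<union>
    {ray (\<lambda>x. c (i - 1) * exp (\<alpha> (i - 1) * x) + c i * exp (\<alpha> i * x)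
            + c (i + 1) * exp (\<alpha> (i + 1) * x)) | i c l.
       i \<in> {2..m - 1} \<and> c (i - 1) > 0 \<and> c (i + 1) > 0 \<and>
       c i = - ((c (i - 1) / l (i - 1)) powr l (i - 1) * (c (i + 1) / l (i + 1)) powr l (i + 1)) \<and>
       l (i - 1) = (\<alpha> (i + 1) - \<alpha> i) / (\<alpha> (i + 1) - \<alpha> (i - 1)) \<and>
       l (i + 1) = (\<alpha> i - \<alpha> (i - 1)) / (\<alpha> (i + 1) - \<alpha> (i - 1)) \<and>
       \<alpha> (i - 1) - \<alpha> (i + 1) \<le> ln ((c (i - 1) * l (i + 1)) / (c (i + 1) * l (i - 1))) \<and>
       ln ((c (i - 1) * l (i + 1)) / (c (i + 1) * l (i - 1))) \<le> \<alpha> (i + 1) - \<alpha> (i - 1)}"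
    (is "?L = {?first} \<union> {?last} \<union> ?middle")
proof -
  interpret exponents m \<alpha> by unfold_locales (fact assms)+
  have "?L = {ray (gen j y) | j y. admissible j y}"
    unfolding sage_cone_eq_gen_cone extremal_ray_iff by blast
  also have "\<dots> = {ray (gen 1 (-1))} \<union> {ray (gen m 1)}
      \<union> {ray (gen i y) | i y. i \<in> {2..m - 1} \<and> y \<in> {-1..1}}" (is "?G = ?H")
  proof
    show "?G \<subseteq> ?H"
    proof
      fix R assume "R \<in> ?G"
      then obtain j y where R: "R = ray (gen j y)" "admissible j y" by blast
      then consider "j = 1" "y = -1" | "j = m" "y = 1" | "j \<in> {2..m - 1}" "y \<in> {-1..1}"
        by (fastforce simp: admissible_def)
      then show "R \<in> ?H" using R(1) by cases blast+
    qed
    have "admissible 1 (-1)" "admissible m 1" using assms(1) by (auto simp: admissible_def)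
    moreover have "admissible i y" if "i \<in> {2..m - 1}" "y \<in> {-1..1}" for i y
      using that by (auto simp: admissible_def)
    ultimately show "?H \<subseteq> ?G" by blast
  qed
  also have "{ray (gen i y) | i y. i \<in> {2..m - 1} \<and> y \<in> {-1..1}} = ?middle"
  proof (intro set_eqI iffI)
    fix R assume "R \<in> ?middle"
    then obtain i c l where R: "R = ray (\<lambda>x. c (i - 1) * exp (\<alpha> (i - 1) * x) + c i * exp (\<alpha> i * x)
            + c (i + 1) * exp (\<alpha> (i + 1) * x))" and i: "i \<in> {2..m - 1}"
      and c: "c (i - 1) > 0" "c (i + 1) > 0"
       "c i = - ((c (i - 1) / l (i - 1)) powr l (i - 1) * (c (i + 1) / l (i + 1)) powr l (i + 1))"
      and l: "l (i - 1) = (\<alpha> (i + 1) - \<alpha> i) / (\<alpha> (i + 1) - \<alpha> (i - 1))"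
       "l (i + 1) = (\<alpha> i - \<alpha> (i - 1)) / (\<alpha> (i + 1) - \<alpha> (i - 1))"
      and bounds: "\<alpha> (i - 1) - \<alpha> (i + 1) \<le> ln ((c (i - 1) * l (i + 1)) / (c (i + 1) * l (i - 1)))"
       "ln ((c (i - 1) * l (i + 1)) / (c (i + 1) * l (i - 1))) \<le> \<alpha> (i + 1) - \<alpha> (i - 1)"
      by (elim CollectE exE conjE) (rule that; assumption)
    define y where "y = ln ((c (i - 1) * l (i + 1)) / (c (i + 1) * l (i - 1)))
      / (\<alpha> (i + 1) - \<alpha> (i - 1))"
    have "\<alpha> (i - 1) < \<alpha> (i + 1)" using i alpha_less[of "i - 1" "i + 1"] by auto
    \<comment> \<open>The bounds on the logarithm say exactly that the zero \<open>y\<close> lies in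
      [-1,1].\<close>
    then have "y \<in> {-1..1}" using bounds unfolding y_def by (simp add: field_simps)
    moreover have "R = ray (gen i y)"
      unfolding R by (rule middle_term_eq_gen[OF i c(1,2) l c(3) y_def])
    ultimately show "R \<in> {ray (gen i y) | i y. i \<in> {2..m - 1} \<and> y \<in> {-1..1}}" using i by blast
  next
    fix R assume "R \<in> {ray (gen i y) | i y. i \<in> {2..m - 1} \<and> y \<in> {-1..1}}"
    then obtain i y where R: "R = ray (gen i y)" and i: "i \<in> {2..m - 1}" and y: "y \<in> {-1..1}"
      by blast
    define D where "D = \<alpha> (i + 1) - \<alpha> (i - 1)"
    have less: "\<alpha> (i - 1) < \<alpha> i" "\<alpha> i < \<alpha> (i + 1)" and "0 < D"
      using i alpha_less[of "i - 1" i] alpha_less[of i "i + 1"] alpha_less[of "i - 1" "i + 1"]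
      by (auto simp: D_def)
    define l where "l k = (if k = i - 1 then \<alpha> (i + 1) - \<alpha> i else \<alpha> i - \<alpha> (i - 1)) / D" for k
    have lpos: "0 < l (i - 1)" "0 < l (i + 1)" using less \<open>0 < D\<close> by (auto simp: l_def)
    \<comment> \<open>The outer coefficients are the weights times
      \<open>exp (- \<alpha> k * y)\<close>, which makes the logarithm in the bounds equal to
      \<open>D * y\<close>. The middle one is the prescribed product with the quotients
      \<open>c k / l k\<close> already simplified.\<close>
    define c where "c k = (if k = i then - ((exp (- \<alpha> (i - 1) * y)) powr l (i - 1)
      * (exp (- \<alpha> (i + 1) * y)) powr l (i + 1)) else l k * exp (- \<alpha> k * y))" for k
    have c: "c (i - 1) = l (i - 1) * exp (- \<alpha> (i - 1) * y)" "c (i + 1) = l (i + 1) * exp (- \<alpha> (i + 1) * y)"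
      using i by (auto simp: c_def)
    have ci: "c i = - ((c (i - 1) / l (i - 1)) powr l (i - 1) * (c (i + 1) / l (i + 1)) powr l (i + 1))"
      unfolding c using lpos by (simp add: c_def)
    have l: "l (i - 1) = (\<alpha> (i + 1) - \<alpha> i) / (\<alpha> (i + 1) - \<alpha> (i - 1))"
       "l (i + 1) = (\<alpha> i - \<alpha> (i - 1)) / (\<alpha> (i + 1) - \<alpha> (i - 1))"
      using i by (auto simp: l_def D_def)
    have "(c (i - 1) * l (i + 1)) / (c (i + 1) * l (i - 1)) = exp (D * y)"
      using lpos unfolding c by (simp add: D_def left_diff_distrib exp_diff exp_minus field_simps)
    then have ln: "ln ((c (i - 1) * l (i + 1)) / (c (i + 1) * l (i - 1))) = D * y" by simp
    have bounds: "\<alpha> (i - 1) - \<alpha> (i + 1) \<le> D * y" "D * y \<le> \<alpha> (i + 1) - \<alpha> (i - 1)"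
      using mult_left_mono[of "-1" y D] mult_left_mono[of y 1 D] y \<open>0 < D\<close> by (auto simp: D_def)
    have cpos: "0 < c (i - 1)" "0 < c (i + 1)" using lpos c by auto
    have "y = ln ((c (i - 1) * l (i + 1)) / (c (i + 1) * l (i - 1))) / (\<alpha> (i + 1) - \<alpha> (i - 1))"
      unfolding ln D_def[symmetric] using \<open>0 < D\<close> by simp
    from middle_term_eq_gen[OF i cpos l ci this]
    have "R = ray (\<lambda>x. c (i - 1) * exp (\<alpha> (i - 1) * x) + c i * exp (\<alpha> i * x)
            + c (i + 1) * exp (\<alpha> (i + 1) * x))" unfolding R by (rule sym)
    then show "R \<in> ?middle"
      using i cpos ci l bounds unfolding ln[symmetric]
      by (intro CollectI exI[of _ i] exI[of _ c] exI[of _ l] conjI)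
  qed
  finally show ?thesis unfolding ray_gen_first ray_gen_last .
qed

end
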